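(* Let $V$ be the Volterra operator on $L^2[0,1]$, $Vf(t)=\int_0^t f(s)\,ds$. Then $\Lambda(V)=(0,1]$.
   Context: $V$ is quasinilpotent. For quasinilpotent $T$ and $x\neq 0$, $k_x(T)=\limsup_{\lambda\to0}\frac{\ln\|(\lambda-T)^{-1}x\|}{\ln\|(\lambda-T)^{-1}\|}$, and the power set is $\Lambda(T)=\{k_x(T): x\neq0\}$. *)

theory Defs
  imports "HOL-Analysis.Analysis"
begin

text \<open>Model of L^2[0,1] (complex scalars): representatives f :: real => complex,
  Lebesgue measurable on [0,1] and square integrable; equality is a.e. on [0,1].\<close>

abbreviation I01 :: "real measure" where
  "I01 \<equiv> lebesgue_on {0..1}"

definition L2 :: "(real \<Rightarrow> complex) \<Rightarrow> bool" where
  "L2 f \<longleftrightarrow> f \<in> borel_measurable I01 \<and> integrable I01 (\<lambda>t. (cmod (f t))\<^sup>2)"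

definition L2norm :: "(real \<Rightarrow> complex) \<Rightarrow> real" where
  "L2norm f = sqrt (integral\<^sup>L I01 (\<lambda>t. (cmod (f t))\<^sup>2))"

definition volterra :: "(real \<Rightarrow> complex) \<Rightarrow> (real \<Rightarrow> complex)" where
  "volterra f = (\<lambda>t. integral\<^sup>L (lebesgue_on {0..t}) f)"

text \<open>y represents (lambda - T)^{-1} x, i.e. y in L^2 and lambda y - T y = x a.e.\<close>
definition res_sol :: "((real \<Rightarrow> complex) \<Rightarrow> (real \<Rightarrow> complex)) \<Rightarrow> complex
    \<Rightarrow> (real \<Rightarrow> complex) \<Rightarrow> (real \<Rightarrow> complex) \<Rightarrow> bool" where
  "res_sol T l x y \<longleftrightarrow> L2 y \<and> (AE t in I01. l * y t - T y t = x t)"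

definition res_vec_norm :: "((real \<Rightarrow> complex) \<Rightarrow> (real \<Rightarrow> complex)) \<Rightarrow> complex
    \<Rightarrow> (real \<Rightarrow> complex) \<Rightarrow> real" where
  "res_vec_norm T l x = L2norm (SOME y. res_sol T l x y)"

definition res_op_norm :: "((real \<Rightarrow> complex) \<Rightarrow> (real \<Rightarrow> complex)) \<Rightarrow> complex \<Rightarrow> real" where
  "res_op_norm T l = Sup {res_vec_norm T l g | g. L2 g \<and> L2norm g \<le> 1}"

definition kpow :: "((real \<Rightarrow> complex) \<Rightarrow> (real \<Rightarrow> complex)) \<Rightarrow> (real \<Rightarrow> complex) \<Rightarrow> ereal" where
  "kpow T x = Limsup (at (0::complex))
      (\<lambda>l. ereal (ln (res_vec_norm T l x) / ln (res_op_norm T l)))"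

definition power_set :: "((real \<Rightarrow> complex) \<Rightarrow> (real \<Rightarrow> complex)) \<Rightarrow> ereal set" where
  "power_set T = {kpow T x | x. L2 x \<and> L2norm x \<noteq> 0}"

end

(* With z = 1 / lambda, the resolvent of V is explicit:
   y(t) = z x(t) + z^2 * integral over [0,t] of exp (z (t - s)) x(s) ds.
   Hence the norm of the resolvent is exp (max 0 (Re z)) up to polynomial factors in |z|, and k_x <= 1.
   If k_x <= 0, then along z = n the integrals of exp (n (1 - s)) x(s) over [0,1] grow
   subexponentially, and Mikusinski's form of the uniqueness of Laplace transforms gives x = 0.
   Finally x(t) = max 0 (t - (1 - sigma)) is mapped to exp (z x(t)) - 1, of norm about
   exp (sigma * max 0 (Re z)), so that k_x = sigma. *)
theory Submission
  imports Defs "HOL-Real_Asymp.Real_Asymp"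
begin

text \<open>Polynomial factors are harmless only where Re z is large and positive. For Re z <= 0 the
  logarithm of the resolvent norm is itself of order ln |z|, so every power of |z| lost in an
  estimate changes the quotient of logarithms. Two choices follow from this. The bound k_x <= 1
  comes from the norm inequality |R x| <= |x| |R|; the explicit estimates alone would only give k_x
  <= 4. And the witness for \<sigma> needs a resolvent image that stays bounded in the left
  half-plane. The simpler candidate, the indicator of [1 - \<sigma>, 1], fails: its image on that
  interval is z exp (z (t - (1 - \<sigma>))), of modulus |z| on the imaginary axis, where the
  operator norm is at most 2 |z|^2, so its exponent is at least 1/2 for every \<sigma>. The
  truncated identity is the Volterra image of this indicator, and the integration removes exactly
  the offending factor z.\<close>

section \<open>Norm estimates in L^2[0,1]\<close>

lemma finite_measure_I01: "finite_measure I01"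
  by (rule finite_measure_lebesgue_on) simp

lemma measure_I01: "measure I01 {0..1} = 1"
  by (simp add: measure_restrict_space)

lemma L2_imp_integrable:
  assumes "L2 f" shows "integrable I01 f"
proof -
  interpret finite_measure I01 by (rule finite_measure_I01)
  have [measurable]: "f \<in> borel_measurable I01" and i: "integrable I01 (\<lambda>t. (cmod (f t))\<^sup>2)"
    using assms by (auto simp: L2_def)
  have "integrable I01 (\<lambda>t. 1 + (cmod (f t))\<^sup>2)" using i by simp
  then show ?thesis
  proof (rule Bochner_Integration.integrable_bound)
    have "u \<le> 1 + u\<^sup>2" for u :: real
      using zero_le_power2[of "u - 1/2"] by (simp add: power2_eq_square algebra_simps)
    then show "AE t in I01. norm (f t) \<le> norm (1 + (cmod (f t))\<^sup>2)"
      by simp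
  qed simp
qed

lemma L2norm_nonneg [simp]: "L2norm f \<ge> 0"
  by (simp add: L2norm_def)

lemma L2norm_sq: "(L2norm f)\<^sup>2 = (LINT t|I01. (cmod (f t))\<^sup>2)"
  by (simp add: L2norm_def)

text \<open>[0,1] is a probability space, so the variance of |f| is nonnegative. This is
  Cauchy-Schwarz against the constant 1.\<close>

lemma L1_le_L2norm:
  assumes "L2 f" shows "(LINT t|I01. cmod (f t)) \<le> L2norm f"
proof -
  interpret finite_measure I01 by (rule finite_measure_I01)
  have i: "integrable I01 (\<lambda>t. (cmod (f t))\<^sup>2)" and j: "integrable I01 (\<lambda>t. cmod (f t))"
    using assms L2_imp_integrable[OF assms] by (auto simp: L2_def)
  define c where "c = (LINT t|I01. cmod (f t))"
  have "0 \<le> (LINT t|I01. (cmod (f t) - c)\<^sup>2)" by simp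
  also have "\<dots> = (LINT t|I01. (cmod (f t))\<^sup>2 - 2 * c * cmod (f t) + c\<^sup>2)"
    by (simp add: power2_diff algebra_simps)
  also have "\<dots> = (L2norm f)\<^sup>2 - 2 * c * c + c\<^sup>2"
    using i j by (simp add: L2norm_sq c_def[symmetric] measure_I01 space_restrict_space)
  finally have "c\<^sup>2 \<le> (L2norm f)\<^sup>2" by (simp add: power2_eq_square)
  then show ?thesis unfolding c_def[symmetric] by (rule power2_le_imp_le) simp
qed

lemma L2norm_cong_AE:
  assumes "f \<in> borel_measurable I01" "g \<in> borel_measurable I01" "AE t in I01. f t = g t"
  shows "L2norm f = L2norm g"
  unfolding L2norm_def
  by (intro arg_cong[where f=sqrt] integral_cong_AE) (use assms in auto)

lemma L2norm_scale: "L2norm (\<lambda>t. c * f t) = cmod c * L2norm f"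
  by (simp add: L2norm_def norm_mult power_mult_distrib real_sqrt_mult)

lemma L2_scale: "L2 f \<Longrightarrow> L2 (\<lambda>t. c * f t)"
  by (auto simp: L2_def norm_mult power_mult_distrib)

text \<open>The parallelogram-type bound |u + v|^2 <= 2 |u|^2 + 2 |v|^2 stands in for the triangle
  inequality; the constant factor it loses is invisible after dividing logarithms.\<close>

lemma L2_add:
  assumes "L2 f" "L2 g" shows "L2 (\<lambda>t. f t + g t)"
    and "L2norm (\<lambda>t. f t + g t) \<le> sqrt (2 * (L2norm f)\<^sup>2 + 2 * (L2norm g)\<^sup>2)"
proof -
  have [measurable]: "f \<in> borel_measurable I01" "g \<in> borel_measurable I01"
    and i: "integrable I01 (\<lambda>t. (cmod (f t))\<^sup>2)" "integrable I01 (\<lambda>t. (cmod (g t))\<^sup>2)"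
    using assms by (auto simp: L2_def)
  have b: "(cmod (f t + g t))\<^sup>2 \<le> 2 * (cmod (f t))\<^sup>2 + 2 * (cmod (g t))\<^sup>2" for t
  proof -
    have "(cmod (f t + g t))\<^sup>2 \<le> (cmod (f t) + cmod (g t))\<^sup>2"
      by (intro power_mono norm_triangle_ineq) simp
    also have "\<dots> \<le> 2 * (cmod (f t))\<^sup>2 + 2 * (cmod (g t))\<^sup>2"
      using zero_le_power2[of "cmod (f t) - cmod (g t)"]
      by (simp add: power2_eq_square algebra_simps)
    finally show ?thesis .
  qed
  have j: "integrable I01 (\<lambda>t. 2 * (cmod (f t))\<^sup>2 + 2 * (cmod (g t))\<^sup>2)" using i by simp
  have k: "integrable I01 (\<lambda>t. (cmod (f t + g t))\<^sup>2)"
    by (rule Bochner_Integration.integrable_bound[OF j]) (use b in simp_all)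
  then show "L2 (\<lambda>t. f t + g t)" by (simp add: L2_def)
  have "(LINT t|I01. (cmod (f t + g t))\<^sup>2) \<le> (LINT t|I01. 2 * (cmod (f t))\<^sup>2 + 2 * (cmod (g t))\<^sup>2)"
    by (rule integral_mono[OF k j]) (rule b)
  also have "\<dots> = 2 * (L2norm f)\<^sup>2 + 2 * (L2norm g)\<^sup>2" using i by (simp add: L2norm_sq)
  finally show "L2norm (\<lambda>t. f t + g t) \<le> sqrt (2 * (L2norm f)\<^sup>2 + 2 * (L2norm g)\<^sup>2)"
    by (simp add: L2norm_def)
qed

lemma L2_bounded:
  assumes "f \<in> borel_measurable I01" "\<And>t. t \<in> {0..1} \<Longrightarrow> cmod (f t) \<le> B"
  shows "L2 f" "L2norm f \<le> B"
proof -
  interpret finite_measure I01 by (rule finite_measure_I01)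
  have [measurable]: "f \<in> borel_measurable I01" by fact
  have B: "0 \<le> B" using order_trans[OF norm_ge_zero assms(2)[of 0]] by simp
  have i: "integrable I01 (\<lambda>t. (cmod (f t))\<^sup>2)"
    by (rule integrable_const_bound[where B="B\<^sup>2"])
       (rule AE_I2, simp add: space_restrict_space power_mono assms(2), measurable)
  then show "L2 f" by (simp add: L2_def)
  have "(L2norm f)\<^sup>2 \<le> (LINT t|I01. B\<^sup>2)"
    unfolding L2norm_sq
    by (rule integral_mono[OF i]) (simp_all add: space_restrict_space power_mono assms(2))
  also have "\<dots> = B\<^sup>2" by (simp add: measure_I01 space_restrict_space)
  finally show "L2norm f \<le> B" using B by (rule power2_le_imp_le)
qed

lemma continuous_imp_measurable_I01:
  fixes f :: "real \<Rightarrow> complex"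
  assumes "continuous_on {0..1} f" shows "f \<in> borel_measurable I01"
  by (rule continuous_imp_measurable_on_sets_lebesgue[OF assms]) simp

lemma integrable_continuous_mult:
  fixes f g :: "real \<Rightarrow> complex"
  assumes "continuous_on {0..1} g" "integrable I01 f"
  shows "integrable I01 (\<lambda>t. g t * f t)"
proof -
  have "bounded (g ` {0..1})"
    by (rule compact_imp_bounded[OF compact_continuous_image[OF assms(1) compact_Icc]])
  then obtain B where B: "\<And>t. t \<in> {0..1} \<Longrightarrow> cmod (g t) \<le> B"
    unfolding bounded_iff by blast
  have [measurable]: "g \<in> borel_measurable I01" by (rule continuous_imp_measurable_I01[OF assms(1)])
  have [measurable]: "f \<in> borel_measurable I01" by (rule borel_measurable_integrable[OF assms(2)])
  have "0 \<le> B" using order_trans[OF norm_ge_zero B[of 0]] by simp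
  then have b: "cmod (g t * f t) \<le> norm (B * cmod (f t))" if "t \<in> {0..1}" for t
    using mult_right_mono[OF B[OF that], of "cmod (f t)"] by (simp add: norm_mult)
  have "integrable I01 (\<lambda>t. B * cmod (f t))" using assms(2) by simp
  then show ?thesis
    by (rule Bochner_Integration.integrable_bound, measurable)
       (rule AE_I2, rule b, simp add: space_restrict_space)
qed

section \<open>Calculus for the Volterra operator\<close>

lemma FTC_lebesgue_on:
  fixes f F :: "real \<Rightarrow> complex"
  assumes "a \<le> b" "continuous_on {a..b} f"
    "\<And>t. t \<in> {a..b} \<Longrightarrow> (F has_vector_derivative f t) (at t within {a..b})"
  shows "integral\<^sup>L (lebesgue_on {a..b}) f = F b - F a"
proof (rule trans[OF lebesgue_integral_eq_integral])
  show "integrable (lebesgue_on {a..b}) f" by (rule continuous_imp_integrable_real[OF assms(2)])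
  show "integral {a..b} f = F b - F a"
    by (rule integral_unique[OF fundamental_theorem_of_calculus[OF assms(1)]]) (rule assms(3))
qed simp

lemma exp_has_vector_derivative_of_real:
  "((\<lambda>s. exp (a * complex_of_real s)) has_vector_derivative a * exp (a * complex_of_real t)) (at t within S)"
proof -
  have "((\<lambda>w. exp (a * w)) has_field_derivative a * exp (a * complex_of_real t)) (at (complex_of_real t))"
    by (auto intro!: derivative_eq_intros)
  then show ?thesis
    by (rule has_vector_derivative_at_within[OF has_vector_derivative_real_field])
qed

lemma volterra_indicator:
  assumes "t \<in> {0..1}"
  shows "volterra f t = (LINT s|I01. indicator {0..t} s *\<^sub>R f s)"
proof -
  have "(LINT s|I01. indicator {0..t} s *\<^sub>R f s)
      = (LINT s|lebesgue. indicator {0..1} s *\<^sub>R (indicator {0..t} s *\<^sub>R f s))"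
    by (rule integral_restrict_space) simp
  also have "\<dots> = (LINT s|lebesgue. indicator {0..t} s *\<^sub>R f s)"
    by (rule Bochner_Integration.integral_cong) (use assms in \<open>auto simp: indicator_def\<close>)
  also have "\<dots> = volterra f t"
    unfolding volterra_def by (rule integral_restrict_space[symmetric]) simp
  finally show ?thesis ..
qed

lemma integrable_subinterval_I01:
  fixes f :: "real \<Rightarrow> complex"
  assumes "integrable I01 f" "0 \<le> a" "b \<le> 1"
  shows "integrable (lebesgue_on {a..b}) f"
  using assms by (intro integrable_subinterval[OF assms(1)]) auto

lemma volterra_HK:
  assumes "integrable I01 f" "t \<in> {0..1}"
  shows "volterra f t = integral {0..t} f"
  unfolding volterra_def
  by (rule lebesgue_integral_eq_integral[OF integrable_subinterval_I01]) (use assms in auto)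

lemma integrable_I01_imp_HK:
  fixes f :: "real \<Rightarrow> complex"
  assumes "integrable I01 f" shows "f integrable_on {0..1}"
  using has_integral_integral_lebesgue_on[OF assms] by (auto simp: integrable_on_def)

lemma volterra_continuous:
  assumes "integrable I01 f" shows "continuous_on {0..1} (volterra f)"
proof -
  have "continuous_on {0..1} (\<lambda>t. integral {0..t} f)"
    by (rule indefinite_integral_continuous_1[OF integrable_I01_imp_HK[OF assms]])
  then show ?thesis by (rule continuous_on_eq) (simp add: volterra_HK[OF assms])
qed

lemma volterra_add:
  assumes "integrable I01 f" "integrable I01 g" "t \<in> {0..1}"
  shows "volterra (\<lambda>s. f s + g s) t = volterra f t + volterra g t"
  unfolding volterra_def
  by (rule Bochner_Integration.integral_add; rule integrable_subinterval_I01) (use assms in auto)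

lemma volterra_scale: "volterra (\<lambda>s. c * f s) t = c * volterra f t"
  by (simp add: volterra_def)

lemma volterra_cong_AE:
  assumes "AE s in I01. f s = g s" "f \<in> borel_measurable I01" "g \<in> borel_measurable I01" "t \<in> {0..1}"
  shows "volterra f t = volterra g t"
  unfolding volterra_indicator[OF assms(4)]
proof (rule integral_cong_AE)
  have [measurable]: "f \<in> borel_measurable I01" "g \<in> borel_measurable I01" "{0..t} \<inter> {0..1} \<in> sets I01"
    using assms by (auto simp: sets_restrict_space_iff)
  have *: "(indicator {0..t} :: real \<Rightarrow> real) \<in> borel_measurable I01"
    by (intro measurable_restrict_space1 borel_measurable_indicator) simp
  show "(\<lambda>s. indicator {0..t} s *\<^sub>R f s) \<in> borel_measurable I01"
       "(\<lambda>s. indicator {0..t} s *\<^sub>R g s) \<in> borel_measurable I01"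
    using * by auto
  show "AE s in I01. indicator {0..t} s *\<^sub>R f s = indicator {0..t} s *\<^sub>R g s"
    by (rule eventually_mono[OF assms(1)]) simp
qed

lemma norm_volterra_le:
  assumes "integrable I01 f" "integrable I01 g" "t \<in> {0..1}"
    and le: "\<And>s. s \<in> {0..t} \<Longrightarrow> cmod (f s) \<le> g s" and nn: "\<And>s. 0 \<le> g s"
  shows "cmod (volterra f t) \<le> (LINT s|I01. g s)"
proof -
  have *: "(indicator {0..t} :: real \<Rightarrow> real) \<in> borel_measurable I01"
    by (intro measurable_restrict_space1 borel_measurable_indicator) simp
  have "(\<lambda>s. indicator {0..t} s *\<^sub>R f s) \<in> borel_measurable I01" using * assms by auto
  then have i: "integrable I01 (\<lambda>s. indicator {0..t} s *\<^sub>R f s)"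
    by (rule Bochner_Integration.integrable_bound[OF assms(1)]) (auto simp: indicator_def)
  have "cmod (volterra f t) \<le> (LINT s|I01. cmod (indicator {0..t} s *\<^sub>R f s))"
    unfolding volterra_indicator[OF assms(3)] by (rule integral_norm_bound)
  also have "\<dots> \<le> (LINT s|I01. g s)"
    by (rule integral_mono[OF integrable_norm[OF i] assms(2)])
       (use le nn in \<open>simp add: indicator_def\<close>)
  finally show ?thesis .
qed

text \<open>The inner integral of the left-hand side becomes explicit after exchanging the two integrations.\<close>

lemma volterra_exp_by_parts:
  assumes f: "integrable I01 f" and t: "t \<in> {0..1}"
  shows "volterra (\<lambda>s. a * exp (a * of_real s) * volterra f s) t
       = exp (a * of_real t) * volterra f t - volterra (\<lambda>s. exp (a * of_real s) * f s) t"
proof -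
  interpret P: finite_measure I01 by (rule finite_measure_I01)
  interpret PS: pair_sigma_finite I01 I01 by unfold_locales
  have [measurable]: "f \<in> borel_measurable I01" using f by simp
  have id [measurable]: "(\<lambda>s. s) \<in> I01 \<rightarrow>\<^sub>M borel"
    by (rule measurable_restrict_space1, rule measurable_completion) simp
  \<comment> \<open>The kernel lives on the triangle r <= s <= t and is extended by 0 to the unit
    square, so that Fubini applies to the product of \<open>I01\<close> with itself;
    \<open>B\<close> bounds \<open>a * exp (a * s)\<close> uniformly on [0,1].\<close>
  define K where "K = (\<lambda>s r. (if s \<le> t \<and> r \<le> s then a * exp (a * of_real s) * f r else 0))"
  have Km: "case_prod K \<in> borel_measurable (I01 \<Otimes>\<^sub>M I01)"
    unfolding K_def by measurable
  define B where "B = cmod a * exp (cmod a)"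
  have bd: "cmod (K s r) \<le> B * cmod (f r)" if "s \<in> {0..1}" for s r
  proof -
    have "Re (a * of_real s) \<le> cmod a"
      using that mult_right_mono[OF complex_Re_le_cmod[of a], of s] mult_left_le[of s "cmod a"] by auto
    then show ?thesis
      by (auto simp: K_def B_def norm_mult intro!: mult_right_mono mult_left_mono)
  qed
  have fB: "integrable I01 (\<lambda>r. B * cmod (f r))" using f by simp
  have ii: "integrable I01 (K s)" if "s \<in> {0..1}" for s
  proof -
    have "(\<lambda>r. K s r) \<in> borel_measurable I01" unfolding K_def by measurable
    then show ?thesis
      by (rule Bochner_Integration.integrable_bound[OF fB])
         (rule AE_I2, use order_trans[OF bd[OF that] abs_ge_self] in simp)
  qed
  have int: "integrable (I01 \<Otimes>\<^sub>M I01) (case_prod K)"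
  proof (rule PS.Fubini_integrable[OF Km])
    have "(\<lambda>s. LINT r|I01. cmod (K s r)) \<in> borel_measurable I01"
      using Km by measurable
    then show "integrable I01 (\<lambda>x. LINT y|I01. norm (case (x, y) of (x, xa) \<Rightarrow> K x xa))"
    proof (simp, intro P.integrable_const_bound[where B="LINT r|I01. B * cmod (f r)"] AE_I2)
      fix s assume "s \<in> space I01"
      then have s: "s \<in> {0..1}" by (simp add: space_restrict_space)
      have "(LINT r|I01. cmod (K s r)) \<le> (LINT r|I01. B * cmod (f r))"
        by (rule integral_mono[OF integrable_norm[OF ii[OF s]] fB]) (rule bd[OF s])
      then show "norm (LINT r|I01. cmod (K s r)) \<le> (LINT r|I01. B * cmod (f r))" by simp
    qed
  qed (use ii in \<open>auto intro!: AE_I2 simp: space_restrict_space\<close>)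
  have Ks: "(LINT r|I01. K s r) = indicator {0..t} s *\<^sub>R (a * exp (a * of_real s) * volterra f s)"
    if s: "s \<in> {0..1}" for s
  proof -
    have "(LINT r|I01. K s r) = (LINT r|I01. indicator {0..t} s *\<^sub>R (a * exp (a * of_real s)) * (indicator {0..s} r *\<^sub>R f r))"
      by (rule Bochner_Integration.integral_cong) (use s in \<open>auto simp: K_def indicator_def space_restrict_space\<close>)
    also have "\<dots> = indicator {0..t} s *\<^sub>R (a * exp (a * of_real s)) * volterra f s"
      unfolding volterra_indicator[OF s] by (rule integral_mult_right_zero)
    finally show ?thesis by simp
  qed
  have Kr: "(LINT s|I01. K s r) = indicator {0..t} r *\<^sub>R ((exp (a * of_real t) - exp (a * of_real r)) * f r)"
    if r: "r \<in> {0..1}" for r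
  proof (cases "r \<le> t")
    case True
    have "(LINT s|I01. K s r) = (LINT s|I01. indicator {r..t} s *\<^sub>R (a * exp (a * of_real s)) * f r)"
      by (rule Bochner_Integration.integral_cong) (use r in \<open>auto simp: K_def indicator_def space_restrict_space\<close>)
    also have "\<dots> = (LINT s|I01. indicator {r..t} s *\<^sub>R (a * exp (a * of_real s))) * f r"
      by (rule integral_mult_left_zero)
    also have "(LINT s|I01. indicator {r..t} s *\<^sub>R (a * exp (a * of_real s)))
        = (LINT s|lebesgue. indicator {0..1} s *\<^sub>R (indicator {r..t} s *\<^sub>R (a * exp (a * of_real s))))"
      by (rule integral_restrict_space) simp
    also have "\<dots> = (LINT s|lebesgue. indicator {r..t} s *\<^sub>R (a * exp (a * of_real s)))"
      by (rule Bochner_Integration.integral_cong) (use r t in \<open>auto simp: indicator_def\<close>)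
    also have "\<dots> = (LINT s|lebesgue_on {r..t}. a * exp (a * of_real s))"
      by (rule integral_restrict_space[symmetric]) simp
    also have "\<dots> = exp (a * of_real t) - exp (a * of_real r)"
      by (rule FTC_lebesgue_on[OF True])
         (rule continuous_intros exp_has_vector_derivative_of_real)+
    finally show ?thesis using r True by (simp add: indicator_def)
  next
    case False
    then have "K s r = 0" for s by (auto simp: K_def)
    then show ?thesis using False by simp
  qed
  have e: "continuous_on {0..1} (\<lambda>s. exp (a * complex_of_real s))" by (intro continuous_intros)
  have "volterra (\<lambda>s. a * exp (a * of_real s) * volterra f s) t = (LINT s|I01. LINT r|I01. K s r)"
    unfolding volterra_indicator[OF t]
    by (rule Bochner_Integration.integral_cong) (auto simp: Ks space_restrict_space)
  also have "\<dots> = (LINT r|I01. LINT s|I01. K s r)" by (rule PS.Fubini_integral[OF int, symmetric])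
  also have "\<dots> = volterra (\<lambda>r. (exp (a * of_real t) - exp (a * of_real r)) * f r) t"
    unfolding volterra_indicator[OF t]
    by (rule Bochner_Integration.integral_cong) (auto simp: Kr space_restrict_space)
  also have "\<dots> = volterra (\<lambda>r. exp (a * of_real t) * f r + (- 1) * (exp (a * of_real r) * f r)) t"
    by (rule arg_cong[where f="\<lambda>h. volterra h t"]) (simp add: left_diff_distrib fun_eq_iff)
  also have "\<dots> = exp (a * of_real t) * volterra f t + (- 1) * volterra (\<lambda>s. exp (a * of_real s) * f s) t"
    by (subst volterra_add[OF _ _ t])
       (simp_all only: volterra_scale integrable_mult_right f integrable_continuous_mult[OF e f])
  finally show ?thesis by simp
qed

section \<open>The explicit resolvent and its uniqueness\<close>

text \<open>The kernel exp (z (t - s)) is split into a factor in t and a factor in s, so that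
  \<open>volterra\<close> is applied to a function independent of t. The bracketed factor turns out
  to be the Volterra image of the whole function.\<close>

definition volterra_res :: "complex \<Rightarrow> (real \<Rightarrow> complex) \<Rightarrow> real \<Rightarrow> complex" where
  "volterra_res z x t = z * x t
     + z * (z * exp (z * of_real t) * volterra (\<lambda>s. exp (- z * of_real s) * x s) t)"

lemma continuous_on_exp_of_real: "continuous_on S (\<lambda>s. exp (a * complex_of_real s))"
  by (intro continuous_intros)

lemma integrable_exp_mult:
  "integrable I01 x \<Longrightarrow> integrable I01 (\<lambda>s. exp (a * complex_of_real s) * x s)"
  by (rule integrable_continuous_mult[OF continuous_on_exp_of_real])

text \<open>Integration by parts with \<open>a = z\<close>, applied to exp (- z s) x(s), produces
  \<open>volterra x\<close> with a minus sign, and this cancels the contribution of the first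
  summand of \<open>volterra_res\<close>.\<close>

lemma volterra_volterra_res:
  assumes x: "integrable I01 x" and t: "t \<in> {0..1}"
  shows "volterra (volterra_res z x) t
       = z * exp (z * of_real t) * volterra (\<lambda>s. exp (- z * of_real s) * x s) t"
proof -
  let ?G = "volterra (\<lambda>s. exp (- z * of_real s) * x s)"
  have G: "integrable I01 (\<lambda>s. exp (- z * of_real s) * x s)" by (rule integrable_exp_mult[OF x])
  have "continuous_on {0..1} (\<lambda>s. z * exp (z * of_real s) * ?G s)"
    by (intro continuous_intros volterra_continuous[OF G])
  then have i: "integrable I01 (\<lambda>s. z * exp (z * of_real s) * ?G s)"
    by (rule continuous_imp_integrable_real)
  have "volterra (volterra_res z x) t
      = z * volterra x t + z * volterra (\<lambda>s. z * exp (z * of_real s) * ?G s) t"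
    unfolding volterra_res_def
    by (subst volterra_add[OF _ _ t])
       (simp_all only: volterra_scale integrable_mult_right x i)
  also have "volterra (\<lambda>s. z * exp (z * of_real s) * ?G s) t
      = exp (z * of_real t) * ?G t - volterra x t"
  proof -
    have "exp (z * complex_of_real s) * (exp (- z * of_real s) * x s) = x s" for s
      by (simp add: exp_minus)
    then show ?thesis using volterra_exp_by_parts[OF G t, of z] by (simp only:)
  qed
  finally show ?thesis by (simp add: algebra_simps)
qed

text \<open>For 0 <= s <= t <= 1 the kernel exp (z (t - s)) has modulus at most exp (max 0 (Re z)),
  so the integral term is bounded pointwise by a multiple of the L^1 norm of \<open>x\<close>. The
  assumption on \<open>cmod z\<close> lets the term z x be absorbed into the same bound.\<close>

lemma L2_volterra_res:
  assumes x: "L2 x" and z: "1 \<le> cmod z"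
  shows "L2 (volterra_res z x)"
    and "L2norm (volterra_res z x) \<le> 2 * (cmod z)\<^sup>2 * exp (max 0 (Re z)) * L2norm x"
proof -
  let ?G = "volterra (\<lambda>s. exp (- z * of_real s) * x s)"
  define m where "m = max 0 (Re z)"
  have xi: "integrable I01 x" by (rule L2_imp_integrable[OF x])
  have G: "integrable I01 (\<lambda>s. exp (- z * of_real s) * x s)" by (rule integrable_exp_mult[OF xi])
  define h where "h = (\<lambda>t. z * (z * exp (z * of_real t) * ?G t))"
  define B where "B = (cmod z)\<^sup>2 * exp m * L2norm x"
  have m: "0 \<le> m" by (simp add: m_def)
  have hm: "h \<in> borel_measurable I01"
    unfolding h_def
    by (rule continuous_imp_measurable_I01) (intro continuous_intros volterra_continuous[OF G])
  have hB: "cmod (h t) \<le> B" if t: "t \<in> {0..1}" for t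
  proof -
    have "cmod (exp (z * of_real t) * ?G t)
        = cmod (volterra (\<lambda>s. exp (z * of_real t) * (exp (- z * of_real s) * x s)) t)"
      by (simp only: volterra_scale)
    also have "\<dots> \<le> (LINT s|I01. exp m * cmod (x s))"
    proof (rule norm_volterra_le[OF _ _ t])
      show "integrable I01 (\<lambda>s. exp (z * of_real t) * (exp (- z * of_real s) * x s))"
        using G by (rule integrable_mult_right)
      show "integrable I01 (\<lambda>s. exp m * cmod (x s))" using xi by simp
    next
      fix s assume s: "s \<in> {0..t}"
      have "Re z * (t - s) \<le> m * (t - s)"
        using s by (intro mult_right_mono) (auto simp: m_def)
      also have "\<dots> \<le> m" using s t m by (intro mult_left_le) auto
      finally have "Re z * (t - s) \<le> m" .
      then have "exp (Re z * t) * exp (- (Re z * s)) \<le> exp m"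
        by (simp add: exp_add[symmetric] algebra_simps)
      then have "exp (Re z * t) * exp (- (Re z * s)) * cmod (x s) \<le> exp m * cmod (x s)"
        by (rule mult_right_mono) simp
      then show "cmod (exp (z * of_real t) * (exp (- z * of_real s) * x s)) \<le> exp m * cmod (x s)"
        by (simp add: norm_mult mult.assoc)
    qed simp
    also have "\<dots> = exp m * (LINT s|I01. cmod (x s))" by simp
    also have "\<dots> \<le> exp m * L2norm x" by (intro mult_left_mono L1_le_L2norm[OF x]) simp
    finally have "(cmod z)\<^sup>2 * cmod (exp (z * of_real t) * ?G t) \<le> (cmod z)\<^sup>2 * (exp m * L2norm x)"
      by (rule mult_left_mono) simp
    then show ?thesis by (simp add: h_def B_def norm_mult power2_eq_square mult.assoc)
  qed
  note hL = L2_bounded[OF hm hB] and zx = L2_scale[OF x, of z]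
  have e: "volterra_res z x = (\<lambda>t. z * x t + h t)"
    by (simp add: fun_eq_iff volterra_res_def h_def)
  show "L2 (volterra_res z x)" unfolding e by (rule L2_add(1)[OF zx hL(1)])
  have B: "0 \<le> B" by (simp add: B_def)
  have "cmod z * 1 \<le> (cmod z)\<^sup>2 * exp m"
    using z m by (intro mult_mono) (auto intro: self_le_power)
  then have zB: "cmod z * L2norm x \<le> B"
    unfolding B_def by (intro mult_right_mono) auto
  have "L2norm (volterra_res z x) \<le> sqrt (2 * (L2norm (\<lambda>t. z * x t))\<^sup>2 + 2 * (L2norm h)\<^sup>2)"
    unfolding e by (rule L2_add(2)[OF zx hL(1)])
  also have "\<dots> \<le> sqrt (2 * B\<^sup>2 + 2 * B\<^sup>2)"
    using zB hL(2) by (intro real_sqrt_le_mono add_mono mult_left_mono power_mono) (auto simp: L2norm_scale)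
  also have "\<dots> = sqrt ((2 * B)\<^sup>2)" by (simp add: power_mult_distrib)
  also have "\<dots> = 2 * B" using B by (simp add: real_sqrt_mult)
  finally show "L2norm (volterra_res z x) \<le> 2 * (cmod z)\<^sup>2 * exp (max 0 (Re z)) * L2norm x"
    by (simp add: B_def m_def mult.assoc)
qed

lemma res_sol_volterra_res:
  assumes x: "L2 x" and z: "1 \<le> cmod z"
  shows "res_sol volterra (1 / z) x (volterra_res z x)"
  unfolding res_sol_def
proof
  show "L2 (volterra_res z x)" by (rule L2_volterra_res(1)[OF x z])
  have "z \<noteq> 0" using z by auto
  then have "1 / z * volterra_res z x t - volterra (volterra_res z x) t = x t" if "t \<in> {0..1}" for t
    unfolding volterra_volterra_res[OF L2_imp_integrable[OF x] that]
    by (simp add: volterra_res_def field_simps)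
  then show "AE t in I01. 1 / z * volterra_res z x t - volterra (volterra_res z x) t = x t"
    by (intro AE_I2) (simp add: space_restrict_space)
qed

text \<open>Integrating factor: multiply the equation by exp (- z s) and integrate. By parts with
  \<open>a = - z\<close>, the two terms containing \<open>y\<close> collapse to the boundary term
  exp (- z t) \<open>volterra y t\<close> / z. Thus \<open>volterra y\<close> is determined at every
  point, and the equation then determines \<open>y\<close> almost everywhere.\<close>

lemma res_sol_imp_eq_volterra_res:
  assumes x: "L2 x" and z: "z \<noteq> 0" and sol: "res_sol volterra (1 / z) x y"
  shows "AE t in I01. y t = volterra_res z x t"
proof -
  have y: "L2 y" and ae: "AE t in I01. 1 / z * y t - volterra y t = x t"
    using sol by (auto simp: res_sol_def)
  have xi: "integrable I01 x" and yi: "integrable I01 y" using x y by (auto intro: L2_imp_integrable)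
  have Yc: "continuous_on {0..1} (volterra y)" by (rule volterra_continuous[OF yi])
  have eY: "integrable I01 (\<lambda>s. (- z) * exp (- z * of_real s) * volterra y s)"
    by (rule continuous_imp_integrable_real) (intro continuous_intros Yc)
  have ey: "integrable I01 (\<lambda>s. exp (- z * of_real s) * y s)" by (rule integrable_exp_mult[OF yi])
  have ex: "integrable I01 (\<lambda>s. exp (- z * of_real s) * x s)" by (rule integrable_exp_mult[OF xi])
  have Y: "volterra y t = z * exp (z * of_real t) * volterra (\<lambda>s. exp (- z * of_real s) * x s) t"
    if t: "t \<in> {0..1}" for t
  proof -
    have "volterra (\<lambda>s. exp (- z * of_real s) * x s) t
        = volterra (\<lambda>s. 1 / z * (exp (- z * of_real s) * y s)
            + 1 / z * ((- z) * exp (- z * of_real s) * volterra y s)) t"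
    proof (rule volterra_cong_AE[OF _ _ _ t])
      show "AE s in I01. exp (- z * complex_of_real s) * x s = 1 / z * (exp (- z * of_real s) * y s)
            + 1 / z * ((- z) * exp (- z * of_real s) * volterra y s)"
        using ae by eventually_elim (use z in \<open>simp add: field_simps\<close>)
    qed (rule borel_measurable_integrable, rule ex,
         rule borel_measurable_integrable, intro Bochner_Integration.integrable_add integrable_mult_right ey eY)
    also have "\<dots> = 1 / z * volterra (\<lambda>s. exp (- z * of_real s) * y s) t
            + 1 / z * volterra (\<lambda>s. (- z) * exp (- z * of_real s) * volterra y s) t"
      by (subst volterra_add[OF _ _ t])
         (simp_all only: volterra_scale integrable_mult_right ey eY)
    also have "\<dots> = 1 / z * (exp (- z * of_real t) * volterra y t)"
      unfolding volterra_exp_by_parts[OF yi t] by (simp add: algebra_simps)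
    finally have "volterra (\<lambda>s. exp (- z * of_real s) * x s) t
      = 1 / z * (exp (- z * of_real t) * volterra y t)" .
    then show ?thesis using z by (simp add: exp_minus)
  qed
  show ?thesis
    using ae AE_space
  proof eventually_elim
    case (elim t)
    then have "1 / z * y t = x t + volterra y t" and t: "t \<in> {0..1}"
      by (auto simp: space_restrict_space diff_eq_eq)
    then have "y t = z * x t + z * volterra y t" using z by (simp add: field_simps)
    then show ?case unfolding Y[OF t] by (simp add: volterra_res_def)
  qed
qed

text \<open>The choice operator may pick any representative, and uniqueness makes the norm
  independent of the pick. An arbitrary solution \<open>y\<close> is allowed so that closed-form
  solutions for special \<open>x\<close> can be inserted directly.\<close>

lemma res_vec_norm_volterra:
  assumes x: "L2 x" and z: "1 \<le> cmod z" and sol: "res_sol volterra (1 / z) x y"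
  shows "res_vec_norm volterra (1 / z) x = L2norm y"
proof -
  have z0: "z \<noteq> 0" using z by auto
  let ?y = "SOME y. res_sol volterra (1 / z) x y"
  have s: "res_sol volterra (1 / z) x ?y" 
    by (rule someI[where P="res_sol volterra (1 / z) x", OF sol])
  have "AE t in I01. ?y t = volterra_res z x t" "AE t in I01. y t = volterra_res z x t"
    using res_sol_imp_eq_volterra_res[OF x z0 s] res_sol_imp_eq_volterra_res[OF x z0 sol] by auto
  then have "AE t in I01. ?y t = y t" by eventually_elim simp
  moreover have "L2 ?y" "L2 y" using s sol unfolding res_sol_def by blast+
  ultimately show ?thesis unfolding res_vec_norm_def
    by (intro L2norm_cong_AE) (simp_all only: L2_def)
qed

lemmas res_vec_norm_volterra_res = res_vec_norm_volterra[OF _ _ res_sol_volterra_res]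

lemma res_vec_norm_volterra_le:
  assumes "L2 x" "1 \<le> cmod z"
  shows "res_vec_norm volterra (1 / z) x \<le> 2 * (cmod z)\<^sup>2 * exp (max 0 (Re z)) * L2norm x"
  using res_vec_norm_volterra_res[OF assms assms] L2_volterra_res(2)[OF assms] by simp

lemma res_vec_norm_volterra_scale:
  assumes x: "L2 x" and z: "1 \<le> cmod z"
  shows "res_vec_norm volterra (1 / z) (\<lambda>t. c * x t) = cmod c * res_vec_norm volterra (1 / z) x"
proof -
  have "volterra (\<lambda>s. exp (- z * of_real s) * (c * x s)) t
      = c * volterra (\<lambda>s. exp (- z * of_real s) * x s) t" for t
    by (subst volterra_scale[symmetric]) (simp only: mult_ac)
  then have "volterra_res z (\<lambda>t. c * x t) = (\<lambda>t. c * volterra_res z x t)"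
    by (simp add: fun_eq_iff volterra_res_def algebra_simps)
  then show ?thesis
    using res_vec_norm_volterra_res[OF L2_scale[OF x] z L2_scale[OF x] z, of c]
      res_vec_norm_volterra_res[OF x z x z] by (simp add: L2norm_scale)
qed

text \<open>Evaluation at 1 is not continuous on L^2, but evaluation of the Volterra image at 1 is,
  and for the resolvent it yields the same Laplace integral.\<close>

lemma laplace_le_res_vec_norm:
  assumes x: "L2 x" and z: "1 \<le> cmod z"
  shows "cmod (z * exp z * volterra (\<lambda>s. exp (- z * of_real s) * x s) 1)
    \<le> res_vec_norm volterra (1 / z) x"
proof -
  note R = L2_volterra_res(1)[OF x z]
  have "cmod (volterra (volterra_res z x) 1) \<le> (LINT s|I01. cmod (volterra_res z x s))"
    using L2_imp_integrable[OF R] by (intro norm_volterra_le) auto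
  also have "\<dots> \<le> res_vec_norm volterra (1 / z) x"
    using L1_le_L2norm[OF R] res_vec_norm_volterra_res[OF x z x z] by simp
  finally show ?thesis
    using volterra_volterra_res[OF L2_imp_integrable[OF x], of 1 z] by simp
qed

section \<open>Two-sided bounds for the operator norm of the resolvent\<close>

abbreviation volterra_op_ln :: "complex \<Rightarrow> real" where
  "volterra_op_ln z \<equiv> ln (res_op_norm volterra (1 / z))"

lemma L2_const: "L2 (\<lambda>_. c)" "L2norm (\<lambda>_. c) \<le> cmod c"
  by (rule L2_bounded[where B="cmod c"]; simp)+

text \<open>A supremum of reals carries information only for a nonempty set that is bounded above;
  both properties are secured here.\<close>

lemma bdd_above_res_vec_norm_volterra:
  assumes z: "1 \<le> cmod z"
  shows "bdd_above {res_vec_norm volterra (1 / z) g | g. L2 g \<and> L2norm g \<le> 1}"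
    and "res_op_norm volterra (1 / z) \<le> 2 * (cmod z)\<^sup>2 * exp (max 0 (Re z))"
proof -
  have le: "res_vec_norm volterra (1 / z) g \<le> 2 * (cmod z)\<^sup>2 * exp (max 0 (Re z))"
    if "L2 g" "L2norm g \<le> 1" for g
    using order_trans[OF res_vec_norm_volterra_le[OF that(1) z] mult_left_mono[OF that(2)]] by simp
  then show "bdd_above {res_vec_norm volterra (1 / z) g | g. L2 g \<and> L2norm g \<le> 1}"
    by (intro bdd_aboveI) blast
  show "res_op_norm volterra (1 / z) \<le> 2 * (cmod z)\<^sup>2 * exp (max 0 (Re z))"
    unfolding res_op_norm_def
  proof (rule cSup_least)
    show "{res_vec_norm volterra (1 / z) g | g. L2 g \<and> L2norm g \<le> 1} \<noteq> {}"
      using L2_const[of 0] by force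
  qed (use le in blast)
qed

lemma res_vec_norm_volterra_le_op:
  assumes x: "L2 x" and z: "1 \<le> cmod z"
  shows "res_vec_norm volterra (1 / z) x \<le> L2norm x * res_op_norm volterra (1 / z)"
proof (cases "L2norm x = 0")
  case True
  then show ?thesis using res_vec_norm_volterra_le[OF x z] by simp
next
  case False
  then have p: "L2norm x > 0" using L2norm_nonneg[of x] by linarith
  define c where "c = complex_of_real (1 / L2norm x)"
  have c: "cmod c = 1 / L2norm x" using p by (simp add: c_def norm_divide)
  have "res_vec_norm volterra (1 / z) (\<lambda>t. c * x t) \<le> res_op_norm volterra (1 / z)"
    unfolding res_op_norm_def
    by (rule cSup_upper[OF _ bdd_above_res_vec_norm_volterra(1)[OF z]])
       (use L2_scale[OF x, of c] p in \<open>auto simp: L2norm_scale c intro!: exI[of _ "\<lambda>t. c * x t"]\<close>)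
  then show ?thesis
    unfolding res_vec_norm_volterra_scale[OF x z] c using p by (simp add: field_simps)
qed

lemma L2norm_ge_on_interval:
  assumes y: "L2 y" and ab: "0 \<le> a" "a \<le> b" "b \<le> 1"
    and c: "0 \<le> c" "\<And>t. t \<in> {a..b} \<Longrightarrow> c \<le> cmod (y t)"
  shows "c\<^sup>2 * (b - a) \<le> (L2norm y)\<^sup>2"
proof -
  interpret finite_measure I01 by (rule finite_measure_I01)
  have s: "{a..b} \<in> sets I01" using ab by (simp add: sets_restrict_space_iff)
  have "measure I01 {a..b} = b - a" using ab by (simp add: measure_restrict_space)
  then have "c\<^sup>2 * (b - a) = (LINT t|I01. c\<^sup>2 * indicator {a..b} t)"
    using s ab by (simp add: space_restrict_space Int_absorb2)
  also have "\<dots> \<le> (L2norm y)\<^sup>2"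
    unfolding L2norm_sq
  proof (rule integral_mono)
    show "integrable I01 (\<lambda>t. c\<^sup>2 * indicator {a..b} t)" using s by (intro integrable_mult_right) (simp add: less_top[symmetric])
    show "integrable I01 (\<lambda>t. (cmod (y t))\<^sup>2)" using y by (simp add: L2_def)
    show "c\<^sup>2 * indicator {a..b} t \<le> (cmod (y t))\<^sup>2" for t
      using power_mono[OF c(2) c(1), of t 2] by (simp add: indicator_def)
  qed
  finally show ?thesis .
qed

lemma volterra_FTC:
  assumes "t \<in> {0..1}" "continuous_on {0..1} f"
    "\<And>s. s \<in> {0..1} \<Longrightarrow> (F has_vector_derivative f s) (at s within {0..1})"
  shows "volterra f t = F t - F 0"
  unfolding volterra_def
proof (rule FTC_lebesgue_on)
  have sub: "{0..t} \<subseteq> {0..1}" using assms(1) by auto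
  show "continuous_on {0..t} f" by (rule continuous_on_subset[OF assms(2) sub])
  show "(F has_vector_derivative f s) (at s within {0..t})" if "s \<in> {0..t}" for s
    using has_vector_derivative_within_subset[OF assms(3) sub] that sub by blast
qed (use assms(1) in simp)

text \<open>The constant function 1 is a near-maximizer: the corresponding solution is z exp (z t).\<close>

lemma res_op_norm_volterra_ge:
  assumes z: "1 \<le> cmod z"
  shows "sqrt (cmod z) * exp (max 0 (Re z) - 1) \<le> res_op_norm volterra (1 / z)"
proof -
  have z0: "z \<noteq> 0" using z by auto
  define y where "y = (\<lambda>t. z * exp (z * complex_of_real t))"
  have yc: "continuous_on {0..1} y" unfolding y_def by (intro continuous_intros)
  have "bounded (y ` {0..1})"
    by (rule compact_imp_bounded[OF compact_continuous_image[OF yc compact_Icc]])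
  then obtain B where "\<And>t. t \<in> {0..1} \<Longrightarrow> cmod (y t) \<le> B" unfolding bounded_iff by blast
  then have y: "L2 y" by (rule L2_bounded(1)[OF continuous_imp_measurable_I01[OF yc]])
  have "volterra y t = exp (z * of_real t) - 1" if t: "t \<in> {0..1}" for t
    using volterra_FTC[OF t yc, of "\<lambda>s. exp (z * of_real s)"] exp_has_vector_derivative_of_real
    by (simp add: y_def)
  then have "1 / z * y t - volterra y t = 1" if "t \<in> {0..1}" for t
    using that z0 by (simp add: y_def)
  then have sol: "res_sol volterra (1 / z) (\<lambda>_. 1) y"
    unfolding res_sol_def using y by (auto intro!: AE_I2 simp: space_restrict_space)
  \<comment> \<open>The modulus of exp (z t) is largest at t = 0 if Re z <= 0 and at t = 1
    otherwise. On an interval of length 1 / |z| at that endpoint, Re z * t moves by at most 1,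
    whence the - 1 in the exponent. The length 1 / |z| turns the factor |z| of \<open>y\<close> into
    sqrt |z| in the norm.\<close>
  define c where "c = cmod z * exp (max 0 (Re z) - 1)"
  have c0: "0 \<le> c" by (simp add: c_def)
  have zi: "0 \<le> 1 / cmod z" "1 / cmod z \<le> 1" using z z0 by (auto simp: field_simps)
  have R: "\<bar>Re z\<bar> \<le> cmod z" by (rule abs_Re_le_cmod)
  have cy: "c \<le> cmod (y t)" if "max 0 (Re z) - 1 \<le> Re z * t" for t
    using that by (simp add: c_def y_def norm_mult mult_left_mono)
  have "c\<^sup>2 * (1 / cmod z) \<le> (L2norm y)\<^sup>2"
  proof (cases "Re z \<le> 0")
    case True
    have "c\<^sup>2 * (1 / cmod z - 0) \<le> (L2norm y)\<^sup>2"
    proof (rule L2norm_ge_on_interval[OF y _ zi c0 cy])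
      fix t assume t: "t \<in> {0..1 / cmod z}"
      have "- (Re z * t) \<le> cmod z * t" using t R mult_right_mono[of "- Re z" "cmod z" t] by auto
      also have "\<dots> \<le> 1" using t z0 by (simp add: field_simps)
      finally show "max 0 (Re z) - 1 \<le> Re z * t" using True by simp
    qed simp
    then show ?thesis by simp
  next
    case False
    have "c\<^sup>2 * (1 - (1 - 1 / cmod z)) \<le> (L2norm y)\<^sup>2"
    proof (rule L2norm_ge_on_interval[OF y _ _ _ c0 cy])
      fix t assume t: "t \<in> {1 - 1 / cmod z..1}"
      have "Re z * (1 - t) \<le> cmod z * (1 / cmod z)"
        using t R False by (intro mult_mono) auto
      also have "\<dots> = 1" using z0 by simp
      finally show "max 0 (Re z) - 1 \<le> Re z * t" using False by (simp add: algebra_simps)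
    qed (use zi in auto)
    then show ?thesis by simp
  qed
  also have "c\<^sup>2 * (1 / cmod z) = (sqrt (cmod z) * exp (max 0 (Re z) - 1))\<^sup>2"
    using z0 by (simp add: c_def power_mult_distrib power2_eq_square)
  finally have "sqrt (cmod z) * exp (max 0 (Re z) - 1) \<le> L2norm y"
    by (rule power2_le_imp_le) simp
  also have "\<dots> \<le> 1 * res_op_norm volterra (1 / z)"
  proof -
    have "L2norm y \<le> L2norm (\<lambda>_. 1) * res_op_norm volterra (1 / z)"
      using res_vec_norm_volterra[OF L2_const(1) z sol] res_vec_norm_volterra_le_op[OF L2_const(1) z, of 1]
      by simp
    moreover have "L2norm (\<lambda>_. 1) = 1" by (simp add: L2norm_def measure_I01 space_restrict_space)
    ultimately show ?thesis by simp
  qed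
  finally show ?thesis by simp
qed

lemma volterra_op_ln_bounds:
  assumes z: "1 \<le> cmod z"
  shows "max 0 (Re z) + ln (cmod z) / 2 - 1 \<le> volterra_op_ln z"
    and "volterra_op_ln z \<le> ln 2 + 2 * ln (cmod z) + max 0 (Re z)"
proof -
  have z0: "cmod z > 0" using z by linarith
  have p: "0 < sqrt (cmod z) * exp (max 0 (Re z) - 1)" using z0 by simp
  note op = res_op_norm_volterra_ge[OF z]
  have "ln (sqrt (cmod z) * exp (max 0 (Re z) - 1)) \<le> volterra_op_ln z"
    using p op by (intro ln_mono) auto
  then show "max 0 (Re z) + ln (cmod z) / 2 - 1 \<le> volterra_op_ln z"
    using z0 by (simp add: ln_mult ln_sqrt)
  have "volterra_op_ln z \<le> ln (2 * (cmod z)\<^sup>2 * exp (max 0 (Re z)))"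
    using bdd_above_res_vec_norm_volterra(2)[OF z] p op by (intro ln_mono) auto
  then show "volterra_op_ln z \<le> ln 2 + 2 * ln (cmod z) + max 0 (Re z)"
    using z0 by (simp add: ln_mult ln_realpow)
qed

text \<open>The summand ln |z| / 2 of the lower bound does this alone, hence also in the left
  half-plane, where the exponential factor is 1.\<close>

lemma eventually_volterra_op_ln_ge: "\<forall>\<^sub>F z in at_infinity. K \<le> volterra_op_ln z"
proof -
  have "\<forall>\<^sub>F z::complex in at_infinity. max 1 (exp (2 * (K + 1))) \<le> cmod z"
    unfolding eventually_at_infinity by blast
  then show ?thesis
  proof eventually_elim
    case (elim z)
    then have "2 * (K + 1) \<le> ln (cmod z)" by (subst ln_ge_iff) auto
    then show ?case using volterra_op_ln_bounds(1)[of z] elim by auto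
  qed
qed

section \<open>Exponents as limits at infinity, and their upper bound 1\<close>

lemma kpow_volterra_eq:
  "kpow volterra x = Limsup at_infinity
    (\<lambda>z. ereal (ln (res_vec_norm volterra (1 / z) x) / volterra_op_ln z))"
  unfolding kpow_def at_to_infinity
  by (subst Limsup_filtermap_eq) (auto simp: inj_on_def inverse_eq_divide)

text \<open>The denominator tends to infinity in all directions, so it absorbs the additive constant
  \<open>K\<close>, that is, any constant factor in the norm estimate.\<close>

lemma kpow_volterra_le:
  assumes "\<forall>\<^sub>F z in at_infinity.
    ln (res_vec_norm volterra (1 / z) x) \<le> K + \<sigma> * volterra_op_ln z"
  shows "kpow volterra x \<le> ereal \<sigma>"
proof (rule ereal_le_epsilon2)
  fix e :: real assume e: "0 < e"
  have "kpow volterra x \<le> ereal (\<sigma> + e)"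
    unfolding kpow_volterra_eq
  proof (rule Limsup_bounded)
    show "\<forall>\<^sub>F z in at_infinity.
      ereal (ln (res_vec_norm volterra (1 / z) x) / volterra_op_ln z) \<le> ereal (\<sigma> + e)"
      using assms eventually_volterra_op_ln_ge[of "max 1 (K / e)"]
    proof eventually_elim
      case (elim z)
      then have "K \<le> e * volterra_op_ln z" using e by (simp add: field_simps)
      then show ?case using elim by (simp add: field_simps)
    qed
  qed
  then show "kpow volterra x \<le> ereal \<sigma> + ereal e" by simp
qed

text \<open>Lower estimates of exponents can be tested on positive integers, where the logarithm of
  the operator norm is n up to a multiple of ln n and a constant.\<close>

lemma kpow_volterra_lessD:
  assumes "kpow volterra x < ereal c"
  shows "\<forall>\<^sub>F n in sequentially.
    ln (res_vec_norm volterra (1 / of_nat n) x) < c * volterra_op_ln (of_nat n)"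
proof -
  have "\<forall>\<^sub>F z in at_infinity.
      ln (res_vec_norm volterra (1 / z) x) < c * volterra_op_ln z"
    using Limsup_lessD[OF assms[unfolded kpow_volterra_eq]] eventually_volterra_op_ln_ge[of 1]
    by eventually_elim (simp add: field_simps)
  then show ?thesis using tendsto_of_nat by (rule eventually_compose_filterlim)
qed

lemma kpow_volterra_le_1:
  assumes x: "L2 x" shows "kpow volterra x \<le> 1"
proof -
  have "kpow volterra x \<le> ereal 1"
  proof (rule kpow_volterra_le)
    have "\<forall>\<^sub>F z::complex in at_infinity. 1 \<le> cmod z" by (auto simp: eventually_at_infinity)
    then show "\<forall>\<^sub>F z in at_infinity. ln (res_vec_norm volterra (1 / z) x)
        \<le> max 0 (ln (L2norm x)) + 1 * volterra_op_ln z"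
      using eventually_volterra_op_ln_ge[of 0]
    proof eventually_elim
      case (elim z)
      have op: "0 < res_op_norm volterra (1 / z)"
        using res_op_norm_volterra_ge[OF elim(1)] elim(1)
        by (smt (verit) exp_gt_zero real_sqrt_gt_zero mult_pos_pos)
      have le: "res_vec_norm volterra (1 / z) x \<le> L2norm x * res_op_norm volterra (1 / z)"
        by (rule res_vec_norm_volterra_le_op[OF x elim(1)])
      \<comment> \<open>Since \<open>ln 0 = 0\<close>, a vanishing norm escapes the monotonicity of
        \<open>ln\<close>; the \<open>max 0\<close> in the constant covers it, together with the
        nonnegativity of \<open>volterra_op_ln z\<close>.\<close>
      show ?case
      proof (cases "0 < res_vec_norm volterra (1 / z) x")
        case True
        then have "0 < L2norm x" using less_le_trans[OF True le] op by (simp add: zero_less_mult_iff)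
        then have "ln (res_vec_norm volterra (1 / z) x) \<le> ln (L2norm x) + volterra_op_ln z"
          using ln_mono[OF le True] op by (simp add: ln_mult)
        then show ?thesis by simp
      next
        case False
        then have "res_vec_norm volterra (1 / z) x = 0" using L2norm_nonneg by (simp add: res_vec_norm_def antisym)
        then show ?thesis using elim by simp
      qed
    qed
  qed
  then show ?thesis by (simp add: one_ereal_def)
qed

section \<open>Positive exponents: uniqueness for Laplace transforms\<close>

text \<open>Lebesgue differentiation: almost everywhere \<open>x\<close> is the limit of its
  averages over intervals to the right, and these averages are differences of values of
  \<open>volterra x\<close>.\<close>

lemma AE_zero_of_volterra_zero:
  assumes x: "integrable I01 x" and zero: "\<And>r. 0 \<le> r \<Longrightarrow> r < 1 \<Longrightarrow> volterra x r = 0"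
  shows "AE t in I01. x t = 0"
proof -
  define f where "f = (\<lambda>s. if s \<in> {0..1} then x s else 0)"
  have xi: "x integrable_on {0..1}" by (rule integrable_I01_imp_HK[OF x])
  have "f integrable_on UNIV" unfolding f_def using xi by (simp only: integrable_restrict_UNIV)
  then have "f integrable_on cbox a b" for a b by (rule integrable_on_subcbox) simp
  then obtain N where N: "negligible N" and
    d: "\<And>t e. t \<notin> N \<Longrightarrow> 0 < e \<Longrightarrow> \<exists>d>0. \<forall>h. 0 < h \<and> h < d \<longrightarrow>
         norm (integral (cbox t (t + h *\<^sub>R One)) f /\<^sub>R h ^ DIM(real) - f t) < e"
    by (rule integrable_ccontinuous_explicit) blast
  have z: "integral {t..t+h} f = 0" if "0 \<le> t" "0 < h" "t + h < 1" for t h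
  proof -
    have "integral {t..t+h} f = integral {t..t+h} x"
      by (rule Henstock_Kurzweil_Integration.integral_cong) (use that in \<open>auto simp: f_def\<close>)
    moreover have "x integrable_on {0..t+h}"
      by (rule integrable_subinterval_real[OF xi]) (use that in auto)
    then have "integral {0..t} x + integral {t..t+h} x = integral {0..t+h} x"
      using that by (intro Henstock_Kurzweil_Integration.integral_combine) auto
    ultimately show ?thesis
      using zero[of t] zero[of "t+h"] volterra_HK[OF x, of t] volterra_HK[OF x, of "t+h"] that by simp
  qed
  have x0: "x t = 0" if t: "t \<notin> N" "0 \<le> t" "t < 1" for t
  proof (rule ccontr)
    assume "x t \<noteq> 0"
    then obtain D where D: "D > 0" "\<And>h. 0 < h \<Longrightarrow> h < D \<Longrightarrow>
         norm (integral (cbox t (t + h *\<^sub>R One)) f /\<^sub>R h ^ DIM(real) - f t) < norm (x t)"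
      using d[OF t(1), of "norm (x t)"] by auto
    define h where "h = min D (1 - t) / 2"
    have h: "0 < h" "h < D" "t + h < 1" using D(1) t by (auto simp: h_def min_def field_simps)
    show False using D(2)[OF h(1,2)] z[OF t(2) h(1,3)] t by (simp add: f_def)
  qed
  \<comment> \<open>No right-hand average at t = 1 stays inside [0,1], so this point joins the
    exceptional null set.\<close>
  have "insert 1 N \<in> null_sets lebesgue"
    using N by (simp add: negligible_iff_null_sets[symmetric])
  then have "AE t in lebesgue. t \<notin> insert 1 N" by (rule AE_not_in)
  then have "AE t in lebesgue. t \<in> {0..1} \<longrightarrow> x t = 0"
    by eventually_elim (use x0 in \<open>auto simp: less_le\<close>)
  then show ?thesis by (subst AE_restrict_space_iff) auto
qed

text \<open>This is exp m times the Laplace transform of \<open>x\<close> at m, the form in which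
  the resolvent supplies it at t = 1.\<close>

definition laplace_at :: "(real \<Rightarrow> complex) \<Rightarrow> real \<Rightarrow> complex" where
  "laplace_at x m = (LINT s|I01. of_real (exp (m * (1 - s))) * x s)"

text \<open>With the constant term removed, putting w = - exp (n (r - s)) yields only exponentials
  at the positive multiples (k + 1) n, where growth bounds are available.\<close>

lemma exp_minus_one_sums: "(\<lambda>k. w ^ Suc k / fact (Suc k)) sums (exp w - 1)" for w :: real
proof -
  have "(\<lambda>k. w ^ k / fact k) sums exp w"
    using exp_converges[of w] by (simp add: divide_inverse mult.commute)
  then show ?thesis by (subst sums_Suc_iff) simp
qed

text \<open>Termwise integration of the series of 1 - exp (- exp (n (r - s))) against x.\<close>

lemma double_exponential_le:
  assumes x: "integrable I01 x" and n: "0 \<le> n" and r: "0 \<le> r" "r \<le> 1"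
    and bnd: "\<And>k. cmod (laplace_at x (real (Suc k) * n)) \<le> exp (\<delta> * (real (Suc k) * n))"
  shows "cmod (LINT s|I01. of_real (1 - exp (- exp (n * (r - s)))) * x s)
       \<le> exp (exp (- n * (1 - r - \<delta>))) - 1"
proof -
  define w where "w = (\<lambda>s. - exp (n * (r - s)))"
  define f where "f = (\<lambda>k s. complex_of_real (w s ^ Suc k / fact (Suc k)) * x s)"
  \<comment> \<open>Since exp (n (r - s)) = exp (- n (1 - r)) exp (n (1 - s)), each power
    contributes exp (- n (1 - r)), and the growth hypothesis contributes exp (\<delta> n);
    \<open>q\<close> is the product.\<close>
  define q where "q = exp (- n * (1 - r - \<delta>))"
  have fi: "integrable I01 (f k)" for k
    unfolding f_def w_def by (rule integrable_continuous_mult[OF _ x]) (intro continuous_intros, simp)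
  have wb: "\<bar>w s\<bar> \<le> exp n" if "s \<in> {0..1}" for s
  proof -
    have "n * (r - s) \<le> n * 1" using that r n by (intro mult_left_mono) auto
    then show ?thesis by (simp add: w_def)
  qed
  have fb: "cmod (f k s) \<le> exp n ^ Suc k / fact (Suc k) * cmod (x s)" if "s \<in> {0..1}" for k s
  proof -
    have "\<bar>w s\<bar> ^ Suc k \<le> exp n ^ Suc k" by (rule power_mono[OF wb[OF that]]) simp
    then have "\<bar>w s\<bar> ^ Suc k / fact (Suc k) * cmod (x s) \<le> exp n ^ Suc k / fact (Suc k) * cmod (x s)"
      by (intro mult_right_mono divide_right_mono) simp_all
    then show ?thesis
      by (simp only: f_def norm_mult norm_of_real abs_divide power_abs abs_of_pos[OF fact_gt_zero])
  qed
  have es: "summable (\<lambda>k. exp n ^ Suc k / fact (Suc k))"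
    by (rule sums_summable[OF exp_minus_one_sums])
  have fsum: "(\<lambda>k. f k s) sums (of_real (exp (w s) - 1) * x s)" for s
    unfolding f_def by (intro sums_mult2 sums_of_real exp_minus_one_sums)
  have "(\<lambda>k. LINT s|I01. f k s) sums (LINT s|I01. (\<Sum>k. f k s))"
  proof (rule sums_integral[OF fi])
    have "summable (\<lambda>k. norm (f k s))" if "s \<in> {0..1}" for s
      by (rule summable_comparison_test'[OF summable_mult2[OF es, of "cmod (x s)"], where N=0])
         (use fb[OF that] in simp)
    then show "AE s in I01. summable (\<lambda>k. norm (f k s))"
      by (intro AE_I2) (simp add: space_restrict_space)
    show "summable (\<lambda>k. LINT s|I01. norm (f k s))"
    proof (rule summable_comparison_test'[OF summable_mult2[OF es, of "LINT s|I01. cmod (x s)"], where N=0])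
      fix k
      have "(LINT s|I01. norm (f k s)) \<le> (LINT s|I01. exp n ^ Suc k / fact (Suc k) * cmod (x s))"
        by (rule integral_mono[OF integrable_norm[OF fi] integrable_mult_right[OF integrable_norm[OF x]]])
           (use fb in \<open>simp add: space_restrict_space\<close>)
      also have "\<dots> = exp n ^ Suc k / fact (Suc k) * (LINT s|I01. cmod (x s))"
        by (rule integral_mult_right_zero)
      finally show "norm (LINT s|I01. norm (f k s)) \<le> exp n ^ Suc k / fact (Suc k) * (LINT s|I01. cmod (x s))"
        by (simp only: real_norm_def abs_of_nonneg[OF integral_nonneg_AE[OF AE_I2[OF norm_ge_zero]]])
    qed
  qed
  then have "(\<Sum>k. LINT s|I01. f k s) = (LINT s|I01. of_real (exp (w s) - 1) * x s)"
    unfolding sums_unique[OF fsum, symmetric] by (rule sums_unique[symmetric])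
  moreover have "cmod (LINT s|I01. f k s) \<le> q ^ Suc k / fact (Suc k)" for k
  proof -
    define c where "c = (-1) ^ Suc k / fact (Suc k) * exp (- (real (Suc k) * n * (1 - r)))"
    have "w s ^ Suc k / fact (Suc k) = c * exp (real (Suc k) * n * (1 - s))" for s
    proof -
      have "w s ^ Suc k = (-1) ^ Suc k * exp (n * (r - s)) ^ Suc k"
        unfolding w_def by (rule power_minus)
      also have "exp (n * (r - s)) ^ Suc k = exp (real (Suc k) * (n * (r - s)))"
        by (rule exp_of_nat_mult[symmetric])
      also have "real (Suc k) * (n * (r - s)) = - (real (Suc k) * n * (1 - r)) + real (Suc k) * n * (1 - s)"
        by (simp add: algebra_simps)
      finally show ?thesis by (simp only: c_def exp_add times_divide_eq_left mult.assoc)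
    qed
    then have "f k s = of_real c * (of_real (exp (real (Suc k) * n * (1 - s))) * x s)" for s
      by (simp only: f_def of_real_mult mult.assoc)
    then have "(LINT s|I01. f k s) = of_real c * laplace_at x (real (Suc k) * n)"
      unfolding laplace_at_def by (simp only: integral_mult_right_zero)
    then have "cmod (LINT s|I01. f k s) \<le> \<bar>c\<bar> * exp (\<delta> * (real (Suc k) * n))"
      using mult_left_mono[OF bnd[of k], of "\<bar>c\<bar>"] by (simp only: norm_mult norm_of_real abs_ge_zero)
    also have "\<bar>c\<bar> = exp (- (real (Suc k) * n * (1 - r))) / fact (Suc k)"
      by (simp add: c_def abs_mult power_abs)
    also have "\<dots> * exp (\<delta> * (real (Suc k) * n)) = exp (real (Suc k) * (- n * (1 - r - \<delta>))) / fact (Suc k)"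
      by (simp only: times_divide_eq_left exp_add[symmetric]) (simp add: algebra_simps)
    also have "\<dots> = q ^ Suc k / fact (Suc k)"
      unfolding q_def by (simp only: exp_of_nat_mult)
    finally show ?thesis .
  qed
  then have "cmod (\<Sum>k. LINT s|I01. f k s) \<le> (\<Sum>k. q ^ Suc k / fact (Suc k))"
    by (rule norm_suminf_le) (rule sums_summable[OF exp_minus_one_sums])
  moreover have "(LINT s|I01. of_real (1 - exp (- exp (n * (r - s)))) * x s)
      = - (LINT s|I01. of_real (exp (w s) - 1) * x s)"
    unfolding w_def Bochner_Integration.integral_minus[symmetric]
    by (rule Bochner_Integration.integral_cong) (simp_all add: algebra_simps)
  ultimately show ?thesis
    using sums_unique[OF exp_minus_one_sums[of q]] by (simp add: q_def)
qed

lemma double_exponential_tendsto: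
  "(\<lambda>n. 1 - exp (- exp (real n * a))) \<longlonglongrightarrow> (if a < 0 then 0 else if a = 0 then 1 - exp (- 1) else 1)"
proof -
  consider "a < 0" | "a = 0" | "a > 0" by linarith
  then show ?thesis
  proof cases
    case 1
    then show ?thesis by simp real_asymp
  next
    case 2
    then show ?thesis by simp
  next
    case 3
    then show ?thesis by simp real_asymp
  qed
qed

text \<open>Mikusinski's argument: the weights 1 - exp (- exp (n (r - s))) tend to the indicator of s < r,
  while the integrals against them tend to 0 by the growth assumption.\<close>

lemma volterra_zero_of_laplace_le:
  assumes x: "integrable I01 x" and r: "0 \<le> r" "r \<le> 1" "r + \<delta> < 1"
    and bnd: "\<forall>\<^sub>F n in sequentially. cmod (laplace_at x (real n)) \<le> exp (\<delta> * real n)"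
  shows "volterra x r = 0"
proof -
  define J where "J = (\<lambda>n. LINT s|I01. of_real (1 - exp (- exp (real n * (r - s)))) * x s)"
  define L where "L = (\<lambda>s. if r - s < 0 then 0 else if r - s = 0 then 1 - exp (- 1) else (1::real))"
  have [measurable]: "x \<in> borel_measurable I01" using x by simp
  have id [measurable]: "(\<lambda>s. s) \<in> I01 \<rightarrow>\<^sub>M borel"
    by (rule measurable_restrict_space1, rule measurable_completion) simp
  have "J \<longlonglongrightarrow> (LINT s|I01. of_real (L s) * x s)"
    unfolding J_def
  proof (rule integral_dominated_convergence)
    show "integrable I01 (\<lambda>s. cmod (x s))" using x by simp
    show "(\<lambda>s. complex_of_real (L s) * x s) \<in> borel_measurable I01" unfolding L_def by measurable
    show "(\<lambda>s. complex_of_real (1 - exp (- exp (real n * (r - s)))) * x s) \<in> borel_measurable I01" for n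
      by measurable
    show "AE s in I01. (\<lambda>n. complex_of_real (1 - exp (- exp (real n * (r - s)))) * x s)
        \<longlonglongrightarrow> complex_of_real (L s) * x s"
      unfolding L_def by (intro AE_I2 tendsto_mult tendsto_of_real tendsto_const double_exponential_tendsto)
    fix n
    have "\<bar>1 - exp (- exp (real n * (r - s)))\<bar> * cmod (x s) \<le> 1 * cmod (x s)" for s
      by (intro mult_right_mono) auto
    then show "AE s in I01. norm (complex_of_real (1 - exp (- exp (real n * (r - s)))) * x s) \<le> cmod (x s)"
      by (intro AE_I2) (simp only: norm_mult norm_of_real mult_1)
  qed
  also have "(LINT s|I01. of_real (L s) * x s) = volterra x r"
  proof -
    \<comment> \<open>The pointwise limit \<open>L\<close> differs from the indicator of [0,r] only
      at s = r, where it is 1 - exp (- 1).\<close>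
    have "{r} \<in> null_sets lebesgue" by (simp add: negligible_iff_null_sets[symmetric])
    then have "AE s in lebesgue. s \<notin> {r}" by (rule AE_not_in)
    then have ae: "AE s in I01. s \<noteq> r" by (subst AE_restrict_space_iff) (auto elim: eventually_mono)
    have "(indicator {0..r} :: real \<Rightarrow> real) \<in> borel_measurable I01"
      by (intro measurable_restrict_space1 borel_measurable_indicator) simp
    then have im: "(\<lambda>s. indicator {0..r} s *\<^sub>R x s) \<in> borel_measurable I01" by measurable
    have Lm: "(\<lambda>s. complex_of_real (L s) * x s) \<in> borel_measurable I01" unfolding L_def by measurable
    have "(LINT s|I01. of_real (L s) * x s) = (LINT s|I01. indicator {0..r} s *\<^sub>R x s)"
    proof (rule integral_cong_AE[OF Lm im])
      show "AE s in I01. complex_of_real (L s) * x s = indicator {0..r} s *\<^sub>R x s"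
        using ae AE_space
        by eventually_elim (auto simp: L_def indicator_def space_restrict_space)
    qed
    then show ?thesis using volterra_indicator[of r x] r by simp
  qed
  finally have J: "J \<longlonglongrightarrow> volterra x r" .
  obtain N where N: "\<And>n. n \<ge> N \<Longrightarrow> cmod (laplace_at x (real n)) \<le> exp (\<delta> * real n)"
    using bnd by (auto simp: eventually_sequentially)
  have "J \<longlonglongrightarrow> 0"
  proof (rule Lim_null_comparison)
    have "cmod (J n) \<le> exp (exp (- real n * (1 - r - \<delta>))) - 1" if "n \<ge> N" for n
      unfolding J_def
    proof (rule double_exponential_le[OF x _ r(1,2)])
      fix k
      \<comment> \<open>The growth bound holds only from \<open>N\<close> on, but once n >= N all
        multiples (k + 1) n are beyond \<open>N\<close> too, so every term of the series is
        controlled at once.\<close>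
      have "N \<le> Suc k * n" using that by (simp add: le_trans)
      from N[OF this] show "cmod (laplace_at x (real (Suc k) * real n)) \<le> exp (\<delta> * (real (Suc k) * real n))"
        by (simp only: of_nat_mult)
    qed simp
    then show "\<forall>\<^sub>F n in sequentially. cmod (J n) \<le> exp (exp (- real n * (1 - r - \<delta>))) - 1"
      by (auto simp: eventually_sequentially)
    have "0 < 1 - r - \<delta>" using r by simp
    then show "(\<lambda>n. exp (exp (- real n * (1 - r - \<delta>))) - 1) \<longlonglongrightarrow> 0"
      by real_asymp
  qed
  with J show ?thesis by (rule LIMSEQ_unique)
qed

lemma kpow_volterra_pos:
  assumes x: "L2 x" and nz: "L2norm x \<noteq> 0"
  shows "0 < kpow volterra x"
proof (rule ccontr)
  assume "\<not> 0 < kpow volterra x"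
  then have k0: "kpow volterra x \<le> 0" by simp
  have xi: "integrable I01 x" by (rule L2_imp_integrable[OF x])
  have bnd: "\<forall>\<^sub>F n in sequentially. cmod (laplace_at x (real n)) \<le> exp (\<delta> * real n)"
    if d: "0 < \<delta>" for \<delta>
  proof -
    \<comment> \<open>Half of \<delta> is kept in reserve: the logarithm of the operator norm is
      only bounded by 2 n, the second n absorbing its logarithmic terms.\<close>
    have "kpow volterra x < ereal (\<delta> / 2)" using d by (intro le_less_trans[OF k0]) simp
    then have lt: "\<forall>\<^sub>F n in sequentially. ln (res_vec_norm volterra (1 / of_nat n) x)
        < \<delta> / 2 * volterra_op_ln (of_nat n)"
      by (rule kpow_volterra_lessD)
    have le: "\<forall>\<^sub>F n in sequentially. ln 2 + 2 * ln (real n) + real n \<le> 2 * real n" by real_asymp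
    show ?thesis
      using lt le eventually_ge_at_top[of 1]
    proof eventually_elim
      case (elim n)
      have n: "1 \<le> cmod (of_nat n)" using elim by simp
      have "volterra_op_ln (of_nat n) \<le> 2 * real n"
        using volterra_op_ln_bounds(2)[OF n] elim by simp
      then have "\<delta> / 2 * volterra_op_ln (of_nat n) \<le> \<delta> / 2 * (2 * real n)"
        using d by (intro mult_left_mono) auto
      also have "\<dots> = \<delta> * real n" by simp
      finally have l: "ln (res_vec_norm volterra (1 / of_nat n) x) \<le> \<delta> * real n"
        using elim(1) by linarith
      have "exp (of_nat n) * exp (- of_nat n * of_real s) = complex_of_real (exp (real n * (1 - s)))" for s
        by (simp add: exp_of_real[symmetric] exp_add[symmetric] algebra_simps)
      then have "exp (of_nat n) * volterra (\<lambda>s. exp (- of_nat n * of_real s) * x s) 1 = laplace_at x (real n)"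
        unfolding volterra_scale[symmetric]
        unfolding volterra_def laplace_at_def mult.assoc[symmetric] by (simp only:)
      then have "real n * cmod (laplace_at x (real n)) \<le> res_vec_norm volterra (1 / of_nat n) x"
        using laplace_le_res_vec_norm[OF x n] by (simp add: norm_mult mult.assoc)
      moreover have "1 * cmod (laplace_at x (real n)) \<le> real n * cmod (laplace_at x (real n))"
        using elim by (intro mult_right_mono) auto
      ultimately have b: "cmod (laplace_at x (real n)) \<le> res_vec_norm volterra (1 / of_nat n) x" by simp
      show ?case
      proof (cases "0 < res_vec_norm volterra (1 / of_nat n) x")
        case True
        then show ?thesis using b l by (smt (verit) exp_le_cancel_iff exp_ln)
      next
        case False
        then show ?thesis using b by (intro order_trans[OF b]) (smt (verit) exp_gt_zero)
      qed
    qed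
  qed
  have "AE t in I01. x t = 0"
  proof (rule AE_zero_of_volterra_zero[OF xi])
    fix r :: real assume r: "0 \<le> r" "r < 1"
    \<comment> \<open>Any positive \<delta> below 1 - r would do; the midpoint is taken.\<close>
    show "volterra x r = 0"
      by (rule volterra_zero_of_laplace_le[OF xi r(1) _ _ bnd[of "(1 - r) / 2"]]) (use r in \<open>simp_all add: field_simps\<close>)
  qed
  then have "L2norm x = L2norm (\<lambda>_. 0)"
    by (intro L2norm_cong_AE) (use xi in simp_all)
  then show False using nz by (simp add: L2norm_def)
qed

section \<open>Functions with prescribed exponent\<close>

text \<open>The truncated identity max 0 (t - \<tau>) realizes the value 1 - \<tau>: the resolvent maps it to
  exp (z * max 0 (t - \<tau>)) - 1.\<close>

lemma hinge_has_vector_derivative: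
  fixes t \<tau> :: real and z :: complex
  assumes z: "z \<noteq> 0"
  shows "((\<lambda>t. exp (z * of_real (max 0 (t - \<tau>))) / z - of_real (max 0 (t - \<tau>))) has_vector_derivative
      (exp (z * of_real (max 0 (t - \<tau>))) - 1)) (at t within S)"
proof -
  \<comment> \<open>Subtracting 1 / z gives F(0) = 0, and F'(0) = 0 as well. Hence composing
    \<open>F\<close> with the truncated identity leaves no corner at \<tau>.\<close>
  define F where "F = (\<lambda>u. exp (z * complex_of_real u) / z - of_real u - 1 / z)"
  have F: "(F has_vector_derivative (exp (z * of_real u) - 1)) (at u)" for u
  proof -
    have "((\<lambda>w. exp (z * w) / z - w - 1 / z) has_field_derivative (exp (z * of_real u) - 1)) (at (complex_of_real u))"
      using z by (auto intro!: derivative_eq_intros)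
    then show ?thesis unfolding F_def by (rule has_vector_derivative_real_field)
  qed
  have F0: "F 0 = 0" by (simp add: F_def)
  have "((\<lambda>t. F (max 0 (t - \<tau>))) has_vector_derivative (exp (z * of_real (max 0 (t - \<tau>))) - 1)) (at t)"
  proof -
    consider "t < \<tau>" | "t = \<tau>" | "t > \<tau>" by linarith
    then show ?thesis
    proof cases
      case 1
      have "((\<lambda>_. 0) has_vector_derivative (0::complex)) (at t)" by simp
      then have "((\<lambda>t. F (max 0 (t - \<tau>))) has_vector_derivative 0) (at t)"
        by (rule has_vector_derivative_transform_within_open[of _ _ _ "{..<\<tau>}"]) (use 1 F0 in auto)
      then show ?thesis using 1 by simp
    next
      case 2
      have "(F has_derivative (\<lambda>h. h *\<^sub>R 0)) (at 0)"
        using F[of 0] by (simp add: has_vector_derivative_def)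
      then have *: "(\<lambda>h. norm (F h) / norm h) \<midarrow>0\<rightarrow> 0"
        by (simp add: has_derivative_at F0)
      \<comment> \<open>The truncated quotient is either 0 or the quotient of \<open>F\<close>
        itself, so it inherits the limit 0.\<close>
      have "(\<lambda>h. norm (F (max 0 h)) / norm h) \<midarrow>0\<rightarrow> 0"
      proof (rule Lim_null_comparison[OF _ *])
        have "norm (F (max 0 h)) / norm h \<le> norm (F h) / norm h" for h
          by (rule divide_right_mono) (auto simp: max_def F0)
        then show "\<forall>\<^sub>F h in at 0. norm (norm (F (max 0 h)) / norm h) \<le> norm (F h) / norm h"
          by simp
      qed
      then show ?thesis using 2
        by (simp add: has_vector_derivative_def has_derivative_at F0)
    next
      case 3
      have "((\<lambda>t. t - \<tau>) has_vector_derivative 1) (at t)"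
        by (auto intro!: derivative_eq_intros)
      then have "((F \<circ> (\<lambda>t. t - \<tau>)) has_vector_derivative (1 *\<^sub>R (exp (z * of_real (t - \<tau>)) - 1))) (at t)"
        by (rule vector_diff_chain_at) (rule F)
      then have "((\<lambda>t. F (max 0 (t - \<tau>))) has_vector_derivative (1 *\<^sub>R (exp (z * of_real (t - \<tau>)) - 1))) (at t)"
        by (rule has_vector_derivative_transform_within_open[of _ _ _ "{\<tau><..}"]) (use 3 in auto)
      then show ?thesis using 3 by simp
    qed
  qed
  then have "((\<lambda>t. F (max 0 (t - \<tau>)) + 1 / z) has_vector_derivative (exp (z * of_real (max 0 (t - \<tau>))) - 1)) (at t)"
    by (intro derivative_eq_intros) auto
  then show ?thesis unfolding F_def by (simp add: has_vector_derivative_at_within)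
qed

lemma continuous_on_hinge:
  "continuous_on S (\<lambda>t. complex_of_real (max 0 (t - \<tau>)))"
  "continuous_on S (\<lambda>t. exp (z * complex_of_real (max 0 (t - \<tau>))) - 1)"
  by (intro continuous_intros)+

lemma volterra_hinge:
  assumes z: "z \<noteq> 0" and \<tau>: "0 \<le> \<tau>" and t: "t \<in> {0..1}"
  shows "volterra (\<lambda>t. exp (z * of_real (max 0 (t - \<tau>))) - 1) t
       = (exp (z * of_real (max 0 (t - \<tau>))) - 1) / z - of_real (max 0 (t - \<tau>))"
proof -
  have "max 0 (0 - \<tau>) = 0" using \<tau> by simp
  then show ?thesis
    using volterra_FTC[OF t continuous_on_hinge(2) hinge_has_vector_derivative[OF z, of \<tau>]] z
    by (simp add: diff_divide_distrib)
qed

lemma L2_hinge: "L2 (\<lambda>t. of_real (max 0 (t - \<tau>)))"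
proof (rule L2_bounded(1)[OF continuous_imp_measurable_I01[OF continuous_on_hinge(1)]])
  show "cmod (of_real (max 0 (t - \<tau>))) \<le> 1 + \<bar>\<tau>\<bar>" if "t \<in> {0..1}" for t
    using that by (auto simp: max_def)
qed

text \<open>The upper bound carries no power of |z|, which keeps the exponent at most \<sigma> in
  every direction. The lower bound passes through the value of \<open>volterra y\<close> at 1, a
  quantity the L^2 norm controls.\<close>

lemma hinge_solution:
  assumes z: "1 \<le> cmod z" and \<tau>: "0 \<le> \<tau>" "\<tau> \<le> 1"
  defines "y \<equiv> (\<lambda>t. exp (z * complex_of_real (max 0 (t - \<tau>))) - 1)"
  shows "res_sol volterra (1 / z) (\<lambda>t. of_real (max 0 (t - \<tau>))) y"
    and "L2norm y \<le> 2 * exp ((1 - \<tau>) * max 0 (Re z))"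
    and "cmod ((exp (z * of_real (1 - \<tau>)) - 1) / z - of_real (1 - \<tau>)) \<le> L2norm y"
proof -
  have z0: "z \<noteq> 0" using z by auto
  define m where "m = max 0 (Re z)"
  have b: "cmod (y t) \<le> 2 * exp ((1 - \<tau>) * m)" if t: "t \<in> {0..1}" for t
  proof -
    have "Re z * max 0 (t - \<tau>) \<le> m * max 0 (t - \<tau>)"
      by (intro mult_right_mono) (simp_all add: m_def)
    also have "\<dots> \<le> m * (1 - \<tau>)"
      using t \<tau> by (intro mult_left_mono) (simp_all add: m_def)
    finally have "cmod (exp (z * of_real (max 0 (t - \<tau>)))) \<le> exp ((1 - \<tau>) * m)"
      by (simp add: mult.commute)
    moreover have "1 \<le> exp ((1 - \<tau>) * m)" using \<tau> by (simp add: m_def)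
    ultimately show ?thesis
      unfolding y_def
      using norm_triangle_ineq4[of "exp (z * of_real (max 0 (t - \<tau>)))" 1] norm_one[where 'a=complex]
      by linarith
  qed
  have ym: "y \<in> borel_measurable I01"
    unfolding y_def by (rule continuous_imp_measurable_I01[OF continuous_on_hinge(2)])
  note yL = L2_bounded[OF ym b]
  show "L2norm y \<le> 2 * exp ((1 - \<tau>) * max 0 (Re z))" using yL(2) by (simp add: m_def)
  have V: "volterra y t = (exp (z * of_real (max 0 (t - \<tau>))) - 1) / z - of_real (max 0 (t - \<tau>))"
    if "t \<in> {0..1}" for t unfolding y_def by (rule volterra_hinge[OF z0 \<tau>(1) that])
  then have "1 / z * y t - volterra y t = of_real (max 0 (t - \<tau>))" if "t \<in> {0..1}" for t
    using that by (simp add: y_def)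
  then show "res_sol volterra (1 / z) (\<lambda>t. of_real (max 0 (t - \<tau>))) y"
    unfolding res_sol_def using yL(1) by (intro conjI AE_I2) (simp_all only: space_restrict_space, simp_all)
  have "cmod (volterra y 1) \<le> (LINT t|I01. cmod (y t))"
    using L2_imp_integrable[OF yL(1)] by (intro norm_volterra_le) auto
  also have "\<dots> \<le> L2norm y" by (rule L1_le_L2norm[OF yL(1)])
  finally show "cmod ((exp (z * of_real (1 - \<tau>)) - 1) / z - of_real (1 - \<tau>)) \<le> L2norm y"
    using V[of 1] \<tau> by simp
qed

lemma kpow_volterra_hinge_le:
  assumes \<sigma>: "0 < \<sigma>" "\<sigma> \<le> 1"
  shows "kpow volterra (\<lambda>t. of_real (max 0 (t - (1 - \<sigma>)))) \<le> ereal \<sigma>"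
proof (rule kpow_volterra_le)
  have "\<forall>\<^sub>F z::complex in at_infinity. exp 2 \<le> cmod z" unfolding eventually_at_infinity by blast
  then show "\<forall>\<^sub>F z in at_infinity. ln (res_vec_norm volterra (1 / z) (\<lambda>t. of_real (max 0 (t - (1 - \<sigma>)))))
      \<le> ln 2 + \<sigma> * volterra_op_ln z"
  proof eventually_elim
    case (elim z)
    have z: "1 \<le> cmod z" using order_trans[OF _ elim, of 1] by simp
    \<comment> \<open>Beyond the threshold exp 2 the term ln |z| / 2 - 1 is nonnegative, so max 0
      (Re z) is dominated by \<open>volterra_op_ln z\<close> with no error term.\<close>
    have "2 \<le> ln (cmod z)" using elim by (subst ln_ge_iff) (use z in auto)
    then have m: "max 0 (Re z) \<le> volterra_op_ln z" using volterra_op_ln_bounds(1)[OF z] by linarith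
    have \<tau>: "0 \<le> 1 - \<sigma>" "1 - \<sigma> \<le> 1" using \<sigma> by auto
    let ?r = "res_vec_norm volterra (1 / z) (\<lambda>t. of_real (max 0 (t - (1 - \<sigma>))))"
    have r: "0 \<le> ?r" "?r \<le> 2 * exp (\<sigma> * max 0 (Re z))"
      using hinge_solution(2)[OF z \<tau>]
      by (simp_all add: res_vec_norm_volterra[OF L2_hinge z hinge_solution(1)[OF z \<tau>]])
    have "ln ?r \<le> ln 2 + \<sigma> * max 0 (Re z)"
    proof (cases "?r = 0")
      case True
      then show ?thesis using \<sigma> by (simp add: add_nonneg_nonneg)
    next
      case False
      then have "ln ?r \<le> ln (2 * exp (\<sigma> * max 0 (Re z)))" using r by (intro ln_mono) auto
      then show ?thesis by (simp add: ln_mult)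
    qed
    also have "\<dots> \<le> ln 2 + \<sigma> * volterra_op_ln z"
      using m \<sigma> by (intro add_left_mono mult_left_mono) auto
    finally show ?case .
  qed
qed

text \<open>At z = n the logarithm of the solution's norm is at least \<sigma> n up to terms of
  order ln n, and that of the operator norm at most n up to such terms; a constant c < \<sigma>
  cannot bound the quotient.\<close>

lemma kpow_volterra_hinge_ge:
  assumes \<sigma>: "0 < \<sigma>" "\<sigma> \<le> 1"
  shows "ereal \<sigma> \<le> kpow volterra (\<lambda>t. of_real (max 0 (t - (1 - \<sigma>))))"
proof (rule ccontr)
  let ?x = "\<lambda>t. complex_of_real (max 0 (t - (1 - \<sigma>)))"
  assume "\<not> ereal \<sigma> \<le> kpow volterra ?x"
  \<comment> \<open>Interpolating above \<open>max 0\<close> makes the constant nonnegative, so that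
    the upper bound for \<open>volterra_op_ln\<close> may be multiplied by it, and also rules out
    infinite values.\<close>
  then have "max 0 (kpow volterra ?x) < ereal \<sigma>" using \<sigma> by simp
  then obtain c' where c': "max 0 (kpow volterra ?x) < c'" "c' < ereal \<sigma>" using dense by blast
  then obtain c where "c' = ereal c" by (cases c') auto
  with c' have c: "0 \<le> c" "c < \<sigma>" "kpow volterra ?x < ereal c" by auto
  have "\<forall>\<^sub>F n in sequentially. c * (ln 2 + 2 * ln (real n) + real n)
      \<le> ln ((exp (real n * \<sigma>) - 1) / real n - \<sigma>)"
    using c(1,2) \<sigma> by real_asymp
  moreover have "\<forall>\<^sub>F n in sequentially. 0 < (exp (real n * \<sigma>) - 1) / real n - \<sigma>"
    using \<sigma> by real_asymp
  ultimately have "\<forall>\<^sub>F n::nat in sequentially. False"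
    using kpow_volterra_lessD[OF c(3)] eventually_ge_at_top[of 1]
  proof eventually_elim
    case (elim n)
    have n: "1 \<le> cmod (of_nat n)" using elim by simp
    have \<tau>: "0 \<le> 1 - \<sigma>" "1 - \<sigma> \<le> 1" using \<sigma> by auto
    have "complex_of_real ((exp (real n * \<sigma>) - 1) / real n - \<sigma>)
        = (exp (of_nat n * of_real (1 - (1 - \<sigma>))) - 1) / of_nat n - of_real (1 - (1 - \<sigma>))"
      by (simp add: exp_of_real[symmetric])
    then have "(exp (real n * \<sigma>) - 1) / real n - \<sigma> \<le> res_vec_norm volterra (1 / of_nat n) ?x"
      using hinge_solution(3)[OF n \<tau>] elim(2)
      unfolding res_vec_norm_volterra[OF L2_hinge n hinge_solution(1)[OF n \<tau>]]
      by (metis abs_of_pos norm_of_real)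
    then have "ln ((exp (real n * \<sigma>) - 1) / real n - \<sigma>) \<le> ln (res_vec_norm volterra (1 / of_nat n) ?x)"
      using elim(2) by (intro ln_mono) auto
    moreover have "c * volterra_op_ln (of_nat n) \<le> c * (ln 2 + 2 * ln (real n) + real n)"
      using volterra_op_ln_bounds(2)[OF n] c(1) by (intro mult_left_mono) auto
    ultimately show False using elim(1,3) by linarith
  qed
  then show False by simp
qed

lemma L2norm_hinge:
  assumes "0 < \<sigma>" "\<sigma> \<le> 1"
  shows "L2norm (\<lambda>t. of_real (max 0 (t - (1 - \<sigma>)))) \<noteq> 0"
proof -
  have "(\<sigma> / 2)\<^sup>2 * (1 - (1 - \<sigma> / 2)) \<le> (L2norm (\<lambda>t. of_real (max 0 (t - (1 - \<sigma>)))))\<^sup>2"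
  proof (rule L2norm_ge_on_interval[OF L2_hinge])
    show "\<sigma> / 2 \<le> cmod (of_real (max 0 (t - (1 - \<sigma>))))" if "t \<in> {1 - \<sigma> / 2..1}" for t
      unfolding norm_of_real using that by auto
  qed (use assms in auto)
  moreover have "0 < (\<sigma> / 2)\<^sup>2 * (1 - (1 - \<sigma> / 2))" using assms by simp
  ultimately show ?thesis by auto
qed

theorem theoremC:
  shows "power_set volterra = ereal ` {0<..1}"
proof (intro equalityI subsetI)
  fix k assume "k \<in> power_set volterra"
  then obtain x where x: "k = kpow volterra x" "L2 x" "L2norm x \<noteq> 0" by (auto simp: power_set_def)
  have "0 < k" "k \<le> 1" using kpow_volterra_pos[OF x(2,3)] kpow_volterra_le_1[OF x(2)] x(1) by auto
  then show "k \<in> ereal ` {0<..1}" by (cases k) auto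
next
  fix k assume "k \<in> ereal ` {0<..1}"
  then obtain \<sigma> where \<sigma>: "k = ereal \<sigma>" "0 < \<sigma>" "\<sigma> \<le> 1" by auto
  then have "kpow volterra (\<lambda>t. of_real (max 0 (t - (1 - \<sigma>)))) = k"
    using kpow_volterra_hinge_le kpow_volterra_hinge_ge by (auto intro: antisym)
  then show "k \<in> power_set volterra"
    unfolding power_set_def using L2_hinge L2norm_hinge[OF \<sigma>(2,3)] by blast
qed

end
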